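(* Let $\mathcal{H}$ be a real Hilbert space, let $D$ be a nonempty closed convex subset of $\mathcal{H}$, let $m\geq 2$ be an integer, let $I=\{1,\ldots,m\}$, and let $(T_i)_{i\in I}$ be a family of nonexpansive operators from $D$ to $D$. Set $T=\frac1m\sum_{i\in I}T_i$ and, for every $\varepsilon\in\,]0,1[$, $$R^{\varepsilon}=\big(\operatorname{Id}+\varepsilon(T_m-\operatorname{Id})\big)\circ\cdots\circ\big(\operatorname{Id}+\varepsilon(T_1-\operatorname{Id})\big).$$ Suppose that there exist $\eta\in\,]0,1]$ and $\beta\in\,]0,+\infty[$ such that for every $\varepsilon\in\,]0,\eta[$ there exists $z^{\varepsilon}\in\operatorname{Fix}R^{\varepsilon}$ with $\|z^{\varepsilon}\|\leq\beta$. Suppose also that $T$ has a unique fixed point, $\operatorname{Fix}T=\{\overline{x}\}$, and that there exist $\alpha\in\,]0,+\infty[$ and $\delta\in\,]0,+\infty[$ such that $$(\forall x\in D\cap B(\overline{x};\delta))\quad\langle x-\overline{x}\mid x-Tx\rangle\geq\alpha\|x-\overline{x}\|^2.$$ In addition, let $y_0\in D$. For every $\varepsilon\in\,]0,\eta[$, let $(y_n^{\varepsilon})_{n\in\mathbb{N}}$ be defined by $y_0^{\varepsilon}=y_0$ and $$(\forall k\in\mathbb{N})(\forall i\in I)\quad y_{km+i}^{\varepsilon}=\big(\operatorname{Id}+\varepsilon(T_i-\operatorname{Id})\big)y_{km+i-1}^{\varepsilon},$$ and, for every $i\in I$, let $x_i^{\varepsilon}$ be the weak limit of $(y_{km+i}^{\varepsilon})_{k\in\mathbb{N}}$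 as $k\to+\infty$. Then, for every $i\in I$, $x_i^{\varepsilon}\to\overline{x}$ (strongly) as $\varepsilon\to0$.
   Context: Nonexpansive means $1$-Lipschitz for the norm of $\mathcal{H}$. $\operatorname{Id}$ is the identity operator, $\operatorname{Fix}$ denotes the set of fixed points, $\langle\cdot\mid\cdot\rangle$ is the scalar product of $\mathcal{H}$, and $B(x;\rho)$ is the closed ball with center $x$ and radius $\rho$. Known fact making the objects well defined: for every $\varepsilon\in\,]0,\eta[$, since $\operatorname{Fix}R^{\varepsilon}\neq\varnothing$, the weak limits $x_i^{\varepsilon}$ exist and satisfy the cycle equations $x_1^{\varepsilon}=(\operatorname{Id}+\varepsilon(T_1-\operatorname{Id}))x_m^{\varepsilon}$ and $x_i^{\varepsilon}=(\operatorname{Id}+\varepsilon(T_i-\operatorname{Id}))x_{i-1}^{\varepsilon}$ for $2\leq i\leq m$. *)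

theory Defs
  imports "HOL-Analysis.Analysis"
begin

definition weakly_converges :: "(nat \<Rightarrow> 'a::real_inner) \<Rightarrow> 'a \<Rightarrow> bool" where
  "weakly_converges X l \<longleftrightarrow> (\<forall>u. (\<lambda>n. X n \<bullet> u) \<longlonglongrightarrow> l \<bullet> u)"

lemma weakly_converges_unique:
  assumes "weakly_converges X l" and "weakly_converges X l'"
  shows "l = l'"
proof -
  have "l \<bullet> u = l' \<bullet> u" for u
    using assms LIMSEQ_unique unfolding weakly_converges_def by blast
  from this[of "l - l'"] have "(l - l') \<bullet> (l - l') = 0"
    by (simp add: inner_diff_left)
  then show ?thesis
    by simp
qed

text \<open>Meaningful only for weakly convergent sequences, in which case the limit is unique
  by the preceding lemma.\<close>

definition weak_lim :: "(nat \<Rightarrow> 'a::real_inner) \<Rightarrow> 'a" where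
  "weak_lim X = (THE l. weakly_converges X l)"

lemma weak_lim_eq: "weakly_converges X l \<Longrightarrow> weak_lim X = l"
  unfolding weak_lim_def by (blast intro: weakly_converges_unique)

text \<open>Operators with domain \<open>D\<close> are total functions whose values outside \<open>D\<close> are
  irrelevant, so \<open>D\<close> appears as an explicit argument.\<close>

definition Fix_on :: "'a set \<Rightarrow> ('a \<Rightarrow> 'a) \<Rightarrow> 'a set" where
  "Fix_on D f = {x \<in> D. f x = x}"

definition relaxation :: "real \<Rightarrow> ('a \<Rightarrow> 'a) \<Rightarrow> 'a \<Rightarrow> 'a::real_vector" where
  "relaxation \<epsilon> f x = x + \<epsilon> *\<^sub>R (f x - x)"

text \<open>The operators are indexed from 1 to \<open>m\<close>, and the one with index 1 is applied first.\<close>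

definition cyclic_comp :: "nat \<Rightarrow> (nat \<Rightarrow> 'a \<Rightarrow> 'a) \<Rightarrow> real \<Rightarrow> 'a \<Rightarrow> 'a::real_vector" where
  "cyclic_comp m T \<epsilon> = fold (\<lambda>i. relaxation \<epsilon> (T i)) [1..<Suc m]"

definition average_op :: "nat \<Rightarrow> (nat \<Rightarrow> 'a \<Rightarrow> 'a) \<Rightarrow> 'a \<Rightarrow> 'a::real_vector" where
  "average_op m T x = (1 / real m) *\<^sub>R (\<Sum>i=1..m. T i x)"

end

theory Submission
  imports Defs
begin

text \<open>
  Fix a small \<open>\<epsilon>\<close> and write \<open>S i\<close> for the composition of the first \<open>i\<close> relaxed operators.

  The iterates of \<open>S m\<close> converge weakly. A relaxed nonexpansive operator is averaged, so one step
  shrinks the distance between two points by an amount that controls the difference of their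
  displacements. Comparing the orbit with a fixed point, whose distance to the orbit converges,
  forces the displacements along the orbit to converge strongly to those along the fixed cycle
  (\<open>orbit_displacements_converge\<close>). In particular the orbit is asymptotically regular, and
  asymptotic regularity together with a fixed point gives weak convergence to some fixed point
  (\<open>asymptotically_regular_iterates_weakly_converge\<close>). The proof of the latter is by asymptotic
  centres: an asymptotic centre of any part of the orbit is a fixed
  point, and the distances of the whole orbit to a fixed point converge, so all parts have the
  same centre \<open>p\<close>; a part staying in a half-space away from \<open>p\<close> would be closer
  to the projection of \<open>p\<close> onto that half-space. Hence the weak limits are
  \<open>S 1 p, \<dots>, S m p = p\<close>, and \<open>p\<close> is bounded independently of \<open>\<epsilon>\<close>.

  The displacements around the closed cycle add up to zero, and every point of the cycle is
  within \<open>O(\<epsilon>)\<close> of \<open>p\<close>. Replacing each of these points by \<open>p\<close> shows that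
  \<open>p\<close> is nearly fixed by the averaged operator: its residual is \<open>O(\<epsilon>)\<close>
  (\<open>fixed_point_residual_le\<close>). The local condition at \<open>xbar\<close> becomes a global lower bound of the
  residual by \<open>\<alpha> * min \<delta> (norm (p - xbar))\<close>, since \<open>Id\<close> minus a nonexpansive operator is monotone
  along rays from \<open>xbar\<close> (\<open>residual_lower_bound\<close>). So \<open>p\<close>, and with it the whole cycle, is within
  \<open>O(\<epsilon>)\<close> of \<open>xbar\<close>.
\<close>

section \<open>Minimisers of uniformly convex functions\<close>

lemma midpoint_identity:
  fixes a :: "'a::real_inner"
  shows "(norm (a - (1/2) *\<^sub>R (v + w)))\<^sup>2
    = ((norm (a - v))\<^sup>2 + (norm (a - w))\<^sup>2) / 2 - (norm (v - w))\<^sup>2 / 4"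
  by (simp only: power2_norm_eq_inner)
     (simp add: algebra_simps inner_simps inner_commute field_simps)

lemma convex_midpoint:
  assumes "convex C" "v \<in> C" "w \<in> C"
  shows "(1/2) *\<^sub>R (v + w) \<in> C"
  using convexD[OF assms, of "1/2" "1/2"] by (simp add: scaleR_add_right)

text \<open>By the midpoint inequality, two points with almost minimal values are close to each other, so a
  minimising sequence is Cauchy. Applied to a minimiser and any other point it gives the quadratic
  growth in the conclusion.\<close>

lemma uniformly_convex_minimiser:
  fixes f :: "'a::{real_inner, complete_space} \<Rightarrow> real"
  assumes C: "closed C" "convex C" "C \<noteq> {}"
    and cont: "continuous_on C f"
    and nonneg: "\<And>v. v \<in> C \<Longrightarrow> 0 \<le> f v"
    and mid: "\<And>v w. v \<in> C \<Longrightarrow> w \<in> C \<Longrightarrow>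
      f ((1/2) *\<^sub>R (v + w)) \<le> (f v + f w) / 2 - (norm (v - w))\<^sup>2 / 4"
  obtains p where "p \<in> C" "\<And>w. w \<in> C \<Longrightarrow> f p + (norm (w - p))\<^sup>2 / 2 \<le> f w"
proof -
  define L where "L = Inf (f ` C)"
  have bdd: "bdd_below (f ` C)"
    using nonneg by (auto intro!: bdd_belowI[of _ 0])
  have L: "L \<le> f v" if "v \<in> C" for v
    unfolding L_def using that bdd by (auto intro: cInf_lower)
  have "\<exists>v\<in>C. f v < L + 1 / real (Suc n)" for n
    using cInf_lessD[of "f ` C" "L + 1 / real (Suc n)"] C(3) unfolding L_def by auto
  then obtain X where X: "\<And>n. X n \<in> C" "\<And>n. f (X n) < L + 1 / real (Suc n)"
    by metis
  have close: "(norm (X i - X j))\<^sup>2 \<le> 4 / real (Suc N)" if "N \<le> i" "N \<le> j" for i j N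
  proof -
    have "1 / real (Suc i) \<le> 1 / real (Suc N)" "1 / real (Suc j) \<le> 1 / real (Suc N)"
      using that by (auto intro!: divide_left_mono)
    then show ?thesis
      using mid[OF X(1) X(1), of i j] L[OF convex_midpoint[OF C(2) X(1) X(1)], of i j]
        X(2)[of i] X(2)[of j] by argo
  qed
  have "Cauchy X"
  proof (rule metric_CauchyI)
    fix e :: real assume "0 < e"
    then have "0 < e\<^sup>2 / 4" by simp
    then obtain N where N: "1 / real (Suc N) < e\<^sup>2 / 4"
      using nat_approx_posE by metis
    have "dist (X i) (X j) < e" if "N \<le> i" "N \<le> j" for i j
    proof -
      have "(norm (X i - X j))\<^sup>2 < e\<^sup>2"
        using close[OF that] N by argo
      then show ?thesis
        using \<open>0 < e\<close> by (simp add: dist_norm power_less_imp_less_base)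
    qed
    then show "\<exists>M. \<forall>i\<ge>M. \<forall>j\<ge>M. dist (X i) (X j) < e" by blast
  qed
  then obtain p where lim: "X \<longlonglongrightarrow> p"
    using Cauchy_convergent_iff convergent_def by blast
  have p: "p \<in> C"
    using closed_sequentially[OF C(1)] X(1) lim by blast
  have "(\<lambda>n. f (X n)) \<longlonglongrightarrow> f p"
    using continuous_on_tendsto_compose[OF cont lim p] X(1) by simp
  moreover have "(\<lambda>n. L + 1 / real (Suc n)) \<longlonglongrightarrow> L + 0"
    by (intro tendsto_add tendsto_const lim_1_over_n[THEN LIMSEQ_Suc])
  ultimately have fp: "f p \<le> L"
    using LIMSEQ_le[of "\<lambda>n. f (X n)" "f p" "\<lambda>n. L + 1 / real (Suc n)" L] X(2)
    by (force intro: less_imp_le)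
  have "f p + (norm (w - p))\<^sup>2 / 2 \<le> f w" if w: "w \<in> C" for w
    using mid[OF w p] L[OF convex_midpoint[OF C(2) w p]] fp by argo
  with p show ?thesis by (rule that)
qed

text \<open>The inequality is the obtuse angle property of the projection \<open>w\<close> of \<open>a\<close>. In this form it says that
  replacing \<open>a\<close> by \<open>w\<close> improves the distance to all points of \<open>C\<close> by a uniform amount, which
  therefore carries over to limits.\<close>

lemma projection_onto_closed_convex:
  fixes a :: "'a::{real_inner, complete_space}"
  assumes C: "closed C" "convex C" "C \<noteq> {}"
  obtains w where "w \<in> C" "\<And>v. v \<in> C \<Longrightarrow> (norm (v - w))\<^sup>2 + (norm (a - w))\<^sup>2 \<le> (norm (v - a))\<^sup>2"
proof -
  obtain w where w: "w \<in> C"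
    and min: "\<And>v. v \<in> C \<Longrightarrow> (norm (a - w))\<^sup>2 + (norm (v - w))\<^sup>2 / 2 \<le> (norm (a - v))\<^sup>2"
    by (rule uniformly_convex_minimiser[OF C, of "\<lambda>v. (norm (a - v))\<^sup>2"])
       (auto intro!: continuous_intros simp: midpoint_identity)
  have "(norm (v - w))\<^sup>2 + (norm (a - w))\<^sup>2 \<le> (norm (v - a))\<^sup>2" if v: "v \<in> C" for v
  proof -
    have "dist a w \<le> dist a u" if "u \<in> C" for u
    proof -
      have "(norm (a - w))\<^sup>2 \<le> (norm (a - u))\<^sup>2"
        using min[OF that] zero_le_power2[of "norm (u - w)"] by argo
      then show ?thesis
        by (simp add: dist_norm abs_le_square_iff[symmetric])
    qed
    then have "(a - w) \<bullet> (v - w) \<le> 0"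
      using any_closest_point_dot[OF C(2,1) w v] by blast
    then show ?thesis
      by (simp only: power2_norm_eq_inner) (simp add: inner_simps inner_commute)
  qed
  with w show ?thesis by (rule that)
qed

section \<open>Asymptotic centres and weak convergence\<close>

text \<open>For bounded sequences this is the limit superior along \<open>F\<close> of the distance to \<open>w\<close>. Letting \<open>F\<close> be
  a filter finer than \<open>sequentially\<close> takes the place of passing to a subsequence.\<close>

definition asymptotic_radius :: "nat filter \<Rightarrow> (nat \<Rightarrow> 'a::real_normed_vector) \<Rightarrow> 'a \<Rightarrow> real" where
  "asymptotic_radius F X w = Inf {c. \<forall>\<^sub>F n in F. norm (X n - w) \<le> c}"

lemma asymptotic_radius_le:
  assumes "F \<noteq> bot" "\<forall>\<^sub>F n in F. norm (X n - w) \<le> c"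
  shows "asymptotic_radius F X w \<le> c"
proof -
  have "0 \<le> c" if "\<forall>\<^sub>F n in F. norm (X n - w) \<le> c" for c
    using eventually_happens'[OF assms(1) that] norm_ge_zero order_trans by blast
  then show ?thesis
    unfolding asymptotic_radius_def using assms(2)
    by (intro cInf_lower bdd_belowI[of _ 0]) auto
qed

context
  fixes F :: "nat filter" and X :: "nat \<Rightarrow> 'a::{real_inner, complete_space}" and B :: real
  assumes F: "F \<noteq> bot" and B: "\<And>n. norm (X n) \<le> B"
begin

lemma eventually_le_asymptotic_radius:
  assumes "asymptotic_radius F X w < c"
  shows "\<forall>\<^sub>F n in F. norm (X n - w) \<le> c"
proof -
  have "\<forall>\<^sub>F n in F. norm (X n - w) \<le> B + norm w"
    by (intro always_eventually allI order_trans[OF norm_triangle_ineq4] add_right_mono B)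
  then have "{c. \<forall>\<^sub>F n in F. norm (X n - w) \<le> c} \<noteq> {}" by blast
  from cInf_lessD[OF this assms[unfolded asymptotic_radius_def]]
  show ?thesis by (auto elim: eventually_mono)
qed

lemma asymptotic_radius_nonneg: "0 \<le> asymptotic_radius F X w"
proof (rule dense_ge)
  fix c assume "asymptotic_radius F X w < c"
  from eventually_happens'[OF F eventually_le_asymptotic_radius[OF this]]
  show "0 \<le> c" using norm_ge_zero order_trans by blast
qed

lemma asymptotic_radius_eq_lim:
  assumes "((\<lambda>n. norm (X n - w)) \<longlongrightarrow> r) F"
  shows "asymptotic_radius F X w = r"
proof (rule antisym)
  show "asymptotic_radius F X w \<le> r"
  proof (rule dense_ge)
    fix c assume "r < c"
    then show "asymptotic_radius F X w \<le> c"
      using eventually_mono[OF order_tendstoD(2)[OF assms \<open>r < c\<close>]]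
      by (intro asymptotic_radius_le[OF F]) (auto intro: less_imp_le)
  qed
  show "r \<le> asymptotic_radius F X w"
  proof (rule dense_ge)
    fix c assume "asymptotic_radius F X w < c"
    then show "r \<le> c"
      using tendsto_upperbound[OF assms] eventually_le_asymptotic_radius F by blast
  qed
qed

lemma asymptotic_radius_lipschitz: "asymptotic_radius F X v \<le> asymptotic_radius F X w + norm (v - w)"
proof (rule dense_ge)
  fix c assume "asymptotic_radius F X w + norm (v - w) < c"
  then have "\<forall>\<^sub>F n in F. norm (X n - w) \<le> c - norm (v - w)"
    by (intro eventually_le_asymptotic_radius) simp
  then have "\<forall>\<^sub>F n in F. norm (X n - v) \<le> c"
    by (rule eventually_mono)
       (smt (verit) norm_triangle_ineq4 diff_diff_eq2 add_diff_cancel diff_add_cancel)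
  then show "asymptotic_radius F X v \<le> c" by (rule asymptotic_radius_le[OF F])
qed

lemma continuous_on_asymptotic_radius: "continuous_on S (asymptotic_radius F X)"
proof -
  have "1-lipschitz_on S (asymptotic_radius F X)"
    using asymptotic_radius_lipschitz
    by (intro lipschitz_onI) (auto simp: dist_norm abs_le_iff diff_le_eq add.commute, metis norm_minus_commute)
  then show ?thesis by (rule lipschitz_on_continuous_on)
qed

text \<open>The squared distances to the \<open>X n\<close> satisfy the midpoint inequality uniformly in \<open>n\<close>, and it
  survives the limit superior. So asymptotic centres, the minimisers of the asymptotic
  radius, exist and are unique.\<close>

lemma asymptotic_radius_midpoint:
  "(asymptotic_radius F X ((1/2) *\<^sub>R (v + w)))\<^sup>2
    \<le> ((asymptotic_radius F X v)\<^sup>2 + (asymptotic_radius F X w)\<^sup>2) / 2 - (norm (v - w))\<^sup>2 / 4"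
  (is "?m\<^sup>2 \<le> (?v\<^sup>2 + ?w\<^sup>2) / 2 - ?d")
proof -
  have "?m\<^sup>2 \<le> ((?v + e)\<^sup>2 + (?w + e)\<^sup>2) / 2 - ?d" if "0 < e" for e
  proof -
    have "\<forall>\<^sub>F n in F. (norm (X n - (1/2) *\<^sub>R (v + w)))\<^sup>2 \<le> ((?v + e)\<^sup>2 + (?w + e)\<^sup>2) / 2 - ?d"
      (is "\<forall>\<^sub>F n in F. ?P n \<le> ?b")
      using eventually_le_asymptotic_radius[of v "?v + e", simplified, OF that]
        eventually_le_asymptotic_radius[of w "?w + e", simplified, OF that]
    proof eventually_elim
      case (elim n)
      then have "(norm (X n - v))\<^sup>2 \<le> (?v + e)\<^sup>2" "(norm (X n - w))\<^sup>2 \<le> (?w + e)\<^sup>2"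
        by (auto intro: power_mono)
      then show ?case unfolding midpoint_identity by argo
    qed
    then have ev: "\<forall>\<^sub>F n in F. ?P n \<le> ?b" and ev': "\<forall>\<^sub>F n in F. norm (X n - (1/2) *\<^sub>R (v + w)) \<le> sqrt ?b"
      by (auto elim!: eventually_mono intro: real_le_rsqrt)
    from eventually_happens'[OF F ev] have "0 \<le> ?b"
      using zero_le_power2 order_trans by blast
    moreover have "?m \<le> sqrt ?b"
      using ev' by (rule asymptotic_radius_le[OF F])
    ultimately show ?thesis
      using power_mono[OF _ asymptotic_radius_nonneg, of _ "sqrt ?b" 2] by simp
  qed
  then have "\<forall>\<^sub>F e in at_right 0. ?m\<^sup>2 \<le> ((?v + e)\<^sup>2 + (?w + e)\<^sup>2) / 2 - ?d"
    by (simp add: eventually_at_right_less eventually_at_filter)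
  moreover have "((\<lambda>e. ((?v + e)\<^sup>2 + (?w + e)\<^sup>2) / 2 - ?d) \<longlongrightarrow> ((?v + 0)\<^sup>2 + (?w + 0)\<^sup>2) / 2 - ?d) (at_right 0)"
    by (intro tendsto_intros) auto
  ultimately show ?thesis
    using tendsto_lowerbound[OF _ _ trivial_limit_at_right_real] by fastforce
qed

lemma asymptotic_centre_exists:
  assumes C: "closed C" "convex C" "C \<noteq> {}"
  obtains p where "p \<in> C"
    "\<And>w. w \<in> C \<Longrightarrow> (asymptotic_radius F X p)\<^sup>2 + (norm (w - p))\<^sup>2 / 2 \<le> (asymptotic_radius F X w)\<^sup>2"
  by (rule uniformly_convex_minimiser[OF C, of "\<lambda>w. (asymptotic_radius F X w)\<^sup>2"])
     (auto intro: asymptotic_radius_midpoint continuous_on_power continuous_on_asymptotic_radius)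

text \<open>By regularity \<open>X n\<close> is close to \<open>R (X n)\<close>, whose distance to \<open>R p\<close> is at most that of \<open>X n\<close> to \<open>p\<close>.
  So the radius at \<open>R p\<close> is no larger than at the centre \<open>p\<close>, and quadratic growth gives \<open>R p = p\<close>.\<close>

lemma asymptotic_centre_fixed:
  assumes D: "closed D" "convex D" "D \<noteq> {}"
    and R: "R ` D \<subseteq> D" "1-lipschitz_on D R"
    and X: "\<And>n. X n \<in> D" "\<And>n. X (Suc n) = R (X n)"
    and regular: "((\<lambda>n. X (Suc n) - X n) \<longlongrightarrow> 0) F"
  obtains p where "p \<in> Fix_on D R" "\<And>w. w \<in> D \<Longrightarrow> asymptotic_radius F X p \<le> asymptotic_radius F X w"
proof -
  obtain p where p: "p \<in> D"
    and min: "\<And>w. w \<in> D \<Longrightarrow> (asymptotic_radius F X p)\<^sup>2 + (norm (w - p))\<^sup>2 / 2 \<le> (asymptotic_radius F X w)\<^sup>2"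
    using asymptotic_centre_exists[OF D] by blast
  have "asymptotic_radius F X (R p) \<le> asymptotic_radius F X p"
  proof (rule dense_ge)
    fix c assume c: "asymptotic_radius F X p < c"
    then obtain c' where c': "asymptotic_radius F X p < c'" "c' < c" using dense by blast
    have "((\<lambda>n. norm (X (Suc n) - X n)) \<longlongrightarrow> 0) F"
      using regular by (rule tendsto_norm_zero)
    then have "\<forall>\<^sub>F n in F. norm (X (Suc n) - X n) < c - c'"
      using c' order_tendstoD(2) by fastforce
    with eventually_le_asymptotic_radius[OF c'(1)]
    have "\<forall>\<^sub>F n in F. norm (X n - R p) \<le> c"
    proof eventually_elim
      case (elim n)
      have "norm (X (Suc n) - R p) \<le> norm (X n - p)"
        using lipschitz_on_normD[OF R(2) X(1) p] X(2) by simp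
      then show ?case
        using elim norm_triangle_ineq4[of "X (Suc n) - R p" "X (Suc n) - X n"] by simp
    qed
    then show "asymptotic_radius F X (R p) \<le> c" by (rule asymptotic_radius_le[OF F])
  qed
  then have "(asymptotic_radius F X (R p))\<^sup>2 \<le> (asymptotic_radius F X p)\<^sup>2"
    by (simp add: power_mono asymptotic_radius_nonneg)
  moreover have "R p \<in> D" using R(1) p by blast
  ultimately have "(norm (R p - p))\<^sup>2 \<le> 0"
    using min[of "R p"] by argo
  then have "p \<in> Fix_on D R" using p by (simp add: Fix_on_def)
  moreover have "asymptotic_radius F X p \<le> asymptotic_radius F X w" if "w \<in> D" for w
  proof (rule power2_le_imp_le)
    show "(asymptotic_radius F X p)\<^sup>2 \<le> (asymptotic_radius F X w)\<^sup>2"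
      using min[OF that] zero_le_power2[of "norm (w - p)"] by argo
  qed (rule asymptotic_radius_nonneg)
  ultimately show ?thesis by (rule that)
qed

text \<open>The sequence eventually lies in the intersection of \<open>D\<close> with a half-space that misses \<open>p\<close>; the
  witness is the projection of \<open>p\<close> onto this intersection.\<close>

lemma smaller_radius_if_eventually_in_halfspace:
  assumes D: "closed D" "convex D" and X: "\<And>n. X n \<in> D"
    and lim: "((\<lambda>n. norm (X n - p)) \<longlongrightarrow> r) F"
    and e: "0 < e" "\<forall>\<^sub>F n in F. e \<le> u \<bullet> (X n - p)"
  obtains w where "w \<in> D" "asymptotic_radius F X w < asymptotic_radius F X p"
proof -
  define C where "C = D \<inter> {v. e + u \<bullet> p \<le> u \<bullet> v}"
  have ev: "\<forall>\<^sub>F n in F. X n \<in> C"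
    using e(2) by (rule eventually_mono) (simp add: C_def X inner_diff_right)
  have C: "closed C" "convex C"
    unfolding C_def using D by (auto intro: closed_halfspace_ge convex_halfspace_ge convex_Int)
  have "C \<noteq> {}" using eventually_happens'[OF F ev] by auto
  then obtain w where w: "w \<in> C"
    and proj: "\<And>v. v \<in> C \<Longrightarrow> (norm (v - w))\<^sup>2 + (norm (p - w))\<^sup>2 \<le> (norm (v - p))\<^sup>2"
    using projection_onto_closed_convex[OF C] by metis
  have "p \<noteq> w" using w e(1) unfolding C_def by auto
  define d where "d = (norm (p - w))\<^sup>2"
  have d: "0 < d" unfolding d_def using \<open>p \<noteq> w\<close> by simp
  have r: "0 \<le> r" using tendsto_lowerbound[OF lim] F by simp
  have "((\<lambda>n. (norm (X n - p))\<^sup>2) \<longlongrightarrow> r\<^sup>2) F"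
    using lim by (rule tendsto_power)
  then have "\<forall>\<^sub>F n in F. (norm (X n - p))\<^sup>2 < r\<^sup>2 + d / 2"
    using d order_tendstoD(2) by fastforce
  with ev have "\<forall>\<^sub>F n in F. norm (X n - w) \<le> sqrt (r\<^sup>2 - d / 2)"
  proof eventually_elim
    case (elim n)
    then have "(norm (X n - w))\<^sup>2 \<le> r\<^sup>2 - d / 2"
      using proj[of "X n"] unfolding d_def by argo
    then show ?case by (rule real_le_rsqrt)
  qed
  then have "asymptotic_radius F X w \<le> sqrt (r\<^sup>2 - d / 2)"
    by (rule asymptotic_radius_le[OF F])
  also have "\<dots> < sqrt (r\<^sup>2)" using d by (intro real_sqrt_less_mono) simp
  also have "\<dots> = asymptotic_radius F X p" using r asymptotic_radius_eq_lim[OF lim] by simp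
  finally show ?thesis using w that unfolding C_def by blast
qed

end

text \<open>The weak limit is the asymptotic centre \<open>p\<close> of the whole sequence. If \<open>X n\<close> stayed away from \<open>p\<close> in
  some direction frequently, the filter \<open>F\<close> of those indices would have its own centre \<open>q\<close>, also a
  fixed point. Distances to fixed points converge along the whole sequence, so they have the same
  limit along \<open>F\<close>; hence \<open>p\<close> is at least as good as \<open>q\<close> for \<open>F\<close> too, which the half-space rules
  out.\<close>

lemma asymptotically_regular_iterates_weakly_converge:
  fixes X :: "nat \<Rightarrow> 'a::{real_inner, complete_space}"
  assumes D: "closed D" "convex D"
    and R: "R ` D \<subseteq> D" "1-lipschitz_on D R"
    and X: "X 0 \<in> D" "\<And>n. X (Suc n) = R (X n)"
    and regular: "(\<lambda>n. X (Suc n) - X n) \<longlonglongrightarrow> 0"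
    and Fix: "Fix_on D R \<noteq> {}"
  obtains p where "p \<in> Fix_on D R" "weakly_converges X p"
proof -
  have XD: "X n \<in> D" for n
    using X R(1) by (induction n) auto
  have dec: "norm (X (Suc n) - q) \<le> norm (X n - q)" if "q \<in> Fix_on D R" for q n
    using lipschitz_on_normD[OF R(2) XD, of q n] that X(2) by (simp add: Fix_on_def)
  have lim: "\<exists>r. (\<lambda>n. norm (X n - q)) \<longlonglongrightarrow> r" if "q \<in> Fix_on D R" for q
    by (rule decseq_convergent[of "\<lambda>n. norm (X n - q)" 0])
       (auto intro: decseq_SucI dec that)
  from Fix obtain z where z: "z \<in> Fix_on D R" by blast
  have "norm (X n - z) \<le> norm (X 0 - z)" for n
    using dec[OF z] by (induction n) (auto intro: order_trans)
  then have B: "norm (X n) \<le> norm (X 0 - z) + norm z" for n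
    using norm_triangle_sub[of "X n" z] by (smt (verit))
  have "D \<noteq> {}" using X by auto
  note centre = asymptotic_centre_fixed[where X = X and R = R, OF _ B D this R XD X(2)]
  obtain p where p: "p \<in> Fix_on D R"
    and pmin: "\<And>w. w \<in> D \<Longrightarrow> asymptotic_radius sequentially X p \<le> asymptotic_radius sequentially X w"
    using centre[OF sequentially_bot regular] by blast
  have below: "\<forall>\<^sub>F n in sequentially. u \<bullet> (X n - p) < e" if e: "0 < e" for u e
  proof (rule ccontr)
    define F where "F = inf sequentially (principal {n. e \<le> u \<bullet> (X n - p)})"
    assume "\<not> ?thesis"
    then have "\<not> eventually (\<lambda>n. False) F"
      unfolding F_def eventually_inf_principal by (simp add: not_le)
    then have F: "F \<noteq> bot" by auto
    have le: "F \<le> sequentially" unfolding F_def by simp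
    obtain r where r: "(\<lambda>n. norm (X n - p)) \<longlonglongrightarrow> r" using lim p by blast
    have rF: "((\<lambda>n. norm (X n - p)) \<longlongrightarrow> r) F" by (rule tendsto_mono[OF le r])
    have "\<forall>\<^sub>F n in F. e \<le> u \<bullet> (X n - p)"
      unfolding F_def eventually_inf_principal by simp
    then obtain w where w: "w \<in> D" "asymptotic_radius F X w < asymptotic_radius F X p"
      using smaller_radius_if_eventually_in_halfspace[OF F B D XD rF e] by blast
    obtain q where q: "q \<in> Fix_on D R"
      and qmin: "\<And>w. w \<in> D \<Longrightarrow> asymptotic_radius F X q \<le> asymptotic_radius F X w"
      using centre[OF F tendsto_mono[OF le regular]] by blast
    obtain s where s: "(\<lambda>n. norm (X n - q)) \<longlonglongrightarrow> s" using lim q by blast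
    have "asymptotic_radius F X p = asymptotic_radius sequentially X p"
      using asymptotic_radius_eq_lim[OF F B rF] asymptotic_radius_eq_lim[OF sequentially_bot B r] by simp
    also have "\<dots> \<le> asymptotic_radius sequentially X q"
      using pmin q by (simp add: Fix_on_def)
    also have "\<dots> = asymptotic_radius F X q"
      using asymptotic_radius_eq_lim[OF F B tendsto_mono[OF le s]]
        asymptotic_radius_eq_lim[OF sequentially_bot B s] by simp
    also have "\<dots> \<le> asymptotic_radius F X w" by (rule qmin[OF w(1)])
    finally show False using w(2) by simp
  qed
  have "(\<lambda>n. X n \<bullet> u) \<longlonglongrightarrow> p \<bullet> u" for u
  proof (rule tendstoI)
    fix e :: real assume "0 < e"
    from below[OF this, of u] below[OF this, of "- u"]
    show "\<forall>\<^sub>F n in sequentially. dist (X n \<bullet> u) (p \<bullet> u) < e"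
      by eventually_elim (auto simp: dist_real_def inner_diff_right inner_commute abs_less_iff)
  qed
  then show ?thesis using that p unfolding weakly_converges_def by blast
qed

section \<open>Cycles of relaxed nonexpansive operators\<close>

lemma cyclic_comp_0 [simp]: "cyclic_comp 0 T \<epsilon> v = v"
  by (simp add: cyclic_comp_def)

lemma cyclic_comp_Suc: "cyclic_comp (Suc i) T \<epsilon> v = relaxation \<epsilon> (T (Suc i)) (cyclic_comp i T \<epsilon> v)"
  by (simp add: cyclic_comp_def)

lemma relaxation_nonexpansive:
  fixes f :: "'a::real_normed_vector \<Rightarrow> 'a"
  assumes "norm (f v - f w) \<le> norm (v - w)" "0 \<le> \<epsilon>" "\<epsilon> \<le> 1"
  shows "norm (relaxation \<epsilon> f v - relaxation \<epsilon> f w) \<le> norm (v - w)"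
proof -
  have "relaxation \<epsilon> f v - relaxation \<epsilon> f w = (1 - \<epsilon>) *\<^sub>R (v - w) + \<epsilon> *\<^sub>R (f v - f w)"
    by (simp add: relaxation_def algebra_simps)
  also have "norm \<dots> \<le> (1 - \<epsilon>) * norm (v - w) + \<epsilon> * norm (f v - f w)"
    using norm_triangle_ineq[of "(1 - \<epsilon>) *\<^sub>R (v - w)" "\<epsilon> *\<^sub>R (f v - f w)"] assms(2,3) by simp
  also have "\<dots> \<le> (1 - \<epsilon>) * norm (v - w) + \<epsilon> * norm (v - w)"
    using assms(1,2) by (intro add_left_mono mult_left_mono)
  finally show ?thesis by (simp add: algebra_simps)
qed

lemma cyclic_comp_displacement:
  "cyclic_comp i T \<epsilon> v - v
    = \<epsilon> *\<^sub>R (\<Sum>j<i. T (Suc j) (cyclic_comp j T \<epsilon> v) - cyclic_comp j T \<epsilon> v)"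
  by (induction i) (simp_all add: cyclic_comp_Suc relaxation_def scaleR_add_right algebra_simps)

text \<open>The difference of the relaxed values is the convex combination of \<open>v - w\<close> and \<open>f v - f w\<close>; strict
  convexity of the squared norm produces the extra term, which is what plain nonexpansiveness lacks
  and asymptotic regularity needs.\<close>

lemma relaxed_nonexpansive_averaged:
  fixes f :: "'a::real_inner \<Rightarrow> 'a"
  assumes "norm (f v - f w) \<le> norm (v - w)" "0 \<le> \<epsilon>"
  shows "(norm (relaxation \<epsilon> f v - relaxation \<epsilon> f w))\<^sup>2
      + \<epsilon> * (1 - \<epsilon>) * (norm ((f v - v) - (f w - w)))\<^sup>2 \<le> (norm (v - w))\<^sup>2"
proof -
  define a b where "a = v - w" and "b = f v - f w"
  have "(norm b)\<^sup>2 \<le> (norm a)\<^sup>2"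
    using assms(1) unfolding a_def b_def by (intro power_mono) auto
  then have "\<epsilon> * (norm b)\<^sup>2 \<le> \<epsilon> * (norm a)\<^sup>2"
    using assms(2) by (rule mult_left_mono)
  moreover have "(norm (a + \<epsilon> *\<^sub>R (b - a)))\<^sup>2 + \<epsilon> * (1 - \<epsilon>) * (norm (b - a))\<^sup>2
      = (norm a)\<^sup>2 - \<epsilon> * (norm a)\<^sup>2 + \<epsilon> * (norm b)\<^sup>2"
    by (simp only: power2_norm_eq_inner)
       (simp add: inner_simps inner_commute algebra_simps power2_eq_square)
  ultimately have "(norm (a + \<epsilon> *\<^sub>R (b - a)))\<^sup>2 + \<epsilon> * (1 - \<epsilon>) * (norm (b - a))\<^sup>2 \<le> (norm a)\<^sup>2"
    by linarith
  moreover have "relaxation \<epsilon> f v - relaxation \<epsilon> f w = a + \<epsilon> *\<^sub>R (b - a)"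
    "(f v - v) - (f w - w) = b - a"
    unfolding a_def b_def relaxation_def by (simp_all add: algebra_simps)
  ultimately show ?thesis by (simp only: a_def)
qed

locale relaxed_cycle =
  fixes D :: "'a::{real_inner, complete_space} set" and m :: nat
    and T :: "nat \<Rightarrow> 'a \<Rightarrow> 'a" and \<epsilon> :: real
  assumes closed: "closed D" and convex: "convex D" and m_pos: "0 < m"
    and maps: "\<And>i. i \<in> {1..m} \<Longrightarrow> T i ` D \<subseteq> D"
    and nonexpansive: "\<And>i. i \<in> {1..m} \<Longrightarrow> 1-lipschitz_on D (T i)"
    and relaxed: "0 < \<epsilon>" "\<epsilon> < 1"
begin

abbreviation S where "S i \<equiv> cyclic_comp i T \<epsilon>"

lemma T_closed: "i < m \<Longrightarrow> v \<in> D \<Longrightarrow> T (Suc i) v \<in> D"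
  using maps[of "Suc i"] by auto

lemma T_nonexpansive: "i < m \<Longrightarrow> v \<in> D \<Longrightarrow> w \<in> D \<Longrightarrow> norm (T (Suc i) v - T (Suc i) w) \<le> norm (v - w)"
  using lipschitz_on_normD[OF nonexpansive[of "Suc i"]] by simp

lemma S_closed: "i \<le> m \<Longrightarrow> v \<in> D \<Longrightarrow> S i v \<in> D"
proof (induction i)
  case (Suc i)
  then have "(1 - \<epsilon>) *\<^sub>R S i v + \<epsilon> *\<^sub>R T (Suc i) (S i v) \<in> D"
    using relaxed T_closed by (intro convexD[OF convex]) auto
  then show ?case by (simp add: cyclic_comp_Suc relaxation_def algebra_simps)
qed simp

lemma S_step_averaged:
  assumes "i < m" "v \<in> D" "w \<in> D"
  shows "(norm (S (Suc i) v - S (Suc i) w))\<^sup>2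
      + \<epsilon> * (1 - \<epsilon>) * (norm ((T (Suc i) (S i v) - S i v) - (T (Suc i) (S i w) - S i w)))\<^sup>2
    \<le> (norm (S i v - S i w))\<^sup>2"
  unfolding cyclic_comp_Suc
  using assms relaxed S_closed T_nonexpansive by (intro relaxed_nonexpansive_averaged) auto

lemma S_step_nonexpansive:
  assumes "i < m" "v \<in> D" "w \<in> D"
  shows "norm (S (Suc i) v - S (Suc i) w) \<le> norm (S i v - S i w)"
  unfolding cyclic_comp_Suc
  using assms relaxed S_closed T_nonexpansive by (intro relaxation_nonexpansive) auto

text \<open>Together with periodicity this sandwiches the distances at all intermediate stages of a period
  between those at its two ends.\<close>

lemma S_distances_antimono:
  assumes "i \<le> j" "j \<le> m" "v \<in> D" "w \<in> D"
  shows "norm (S j v - S j w) \<le> norm (S i v - S i w)"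
  using assms(1,2)
proof (induction j rule: dec_induct)
  case (step j)
  then show ?case using S_step_nonexpansive[of j v w] assms(3,4) by simp
qed simp

lemma S_nonexpansive: "1-lipschitz_on D (S m)"
  using S_distances_antimono[of 0 m] by (intro lipschitz_onI) (auto simp: dist_norm)

lemma orbit_distance_decreasing:
  assumes z: "z \<in> Fix_on D (S m)" and u: "\<And>k. u k \<in> D" "\<And>k. u (Suc k) = S m (u k)"
  shows "decseq (\<lambda>k. norm (u k - z))"
  using S_distances_antimono[of 0 m _ z] z u by (intro decseq_SucI) (auto simp: Fix_on_def)

text \<open>At every stage of the period the distance between the orbit and the cycle through \<open>z\<close> tends to
  one limit \<open>r\<close>, so the gap in the averagedness inequality tends to zero, and with it the
  difference of the individual displacements.\<close>

lemma orbit_displacements_converge: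
  assumes z: "z \<in> Fix_on D (S m)" and u: "\<And>k. u k \<in> D" "\<And>k. u (Suc k) = S m (u k)"
    and i: "i \<le> m"
  shows "(\<lambda>k. S i (u k) - u k) \<longlonglongrightarrow> S i z - z"
proof -
  have zD: "z \<in> D" and Sz: "S m z = z" using z by (auto simp: Fix_on_def)
  obtain r where r: "(\<lambda>k. norm (u k - z)) \<longlonglongrightarrow> r"
    using decseq_convergent[OF orbit_distance_decreasing[where u = u, OF z u], of 0] by auto
  have stage: "(\<lambda>k. (norm (S j (u k) - S j z))\<^sup>2) \<longlonglongrightarrow> r\<^sup>2" if "j \<le> m" for j
  proof -
    have "norm (u (Suc k) - z) \<le> norm (S j (u k) - S j z)" for k
      using S_distances_antimono[OF that order_refl u(1) zD, of k] Sz u(2) by simp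
    moreover have "norm (S j (u k) - S j z) \<le> norm (u k - z)" for k
      using S_distances_antimono[OF _ that u(1) zD, of 0 k] by simp
    ultimately have "(\<lambda>k. norm (S j (u k) - S j z)) \<longlonglongrightarrow> r"
      using real_tendsto_sandwich[OF _ _ LIMSEQ_Suc[OF r] r] by simp
    then show ?thesis by (rule tendsto_power)
  qed
  have defect: "(\<lambda>k. T (Suc j) (S j (u k)) - S j (u k)) \<longlonglongrightarrow> T (Suc j) (S j z) - S j z"
    if "j < m" for j
  proof -
    let ?b = "\<lambda>k. (T (Suc j) (S j (u k)) - S j (u k)) - (T (Suc j) (S j z) - S j z)"
    have c: "0 < \<epsilon> * (1 - \<epsilon>)" using relaxed by simp
    have lim: "(\<lambda>k. ((norm (S j (u k) - S j z))\<^sup>2 - (norm (S (Suc j) (u k) - S (Suc j) z))\<^sup>2)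
        / (\<epsilon> * (1 - \<epsilon>))) \<longlonglongrightarrow> 0"
      using tendsto_diff[OF stage[of j] stage[of "Suc j"]] that by (intro tendsto_divide_zero) simp
    have "(norm (?b k))\<^sup>2 \<le> ((norm (S j (u k) - S j z))\<^sup>2 - (norm (S (Suc j) (u k) - S (Suc j) z))\<^sup>2)
        / (\<epsilon> * (1 - \<epsilon>))" for k
      using S_step_averaged[OF that u(1) zD, of k] c by (simp add: pos_le_divide_eq mult.commute)
    then have "(\<lambda>k. (norm (?b k))\<^sup>2) \<longlonglongrightarrow> 0"
      by (intro Lim_null_comparison[OF _ lim] always_eventually) simp
    then have "(\<lambda>k. sqrt ((norm (?b k))\<^sup>2)) \<longlonglongrightarrow> sqrt 0"
      by (rule tendsto_real_sqrt)
    then have "?b \<longlonglongrightarrow> 0" by (simp add: tendsto_norm_zero_iff)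
    then show ?thesis by (simp add: LIM_zero_iff)
  qed
  show ?thesis
    unfolding cyclic_comp_displacement using i by (intro tendsto_scaleR tendsto_const tendsto_sum defect) auto
qed

text \<open>The stage \<open>i = m\<close> of the previous lemma is asymptotic regularity of \<open>u\<close>. Once the weak limit \<open>p\<close>
  is found, the same lemma, now for \<open>p\<close> as reference point, transports it to the other stages,
  because the displacements converge strongly.\<close>

lemma orbit_weakly_converges:
  assumes nonempty: "Fix_on D (S m) \<noteq> {}" and u: "u 0 \<in> D" "\<And>k. u (Suc k) = S m (u k)"
  obtains p where "p \<in> Fix_on D (S m)" "\<And>i. i \<le> m \<Longrightarrow> weakly_converges (\<lambda>k. S i (u k)) (S i p)"
proof -
  have uD: "u k \<in> D" for k
    using u S_closed[of m] by (induction k) auto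
  obtain z where z: "z \<in> Fix_on D (S m)" using nonempty by blast
  have "(\<lambda>k. u (Suc k) - u k) \<longlonglongrightarrow> 0"
    using orbit_displacements_converge[where u = u, OF z uD u(2) order_refl] z u(2) by (simp add: Fix_on_def)
  then obtain p where p: "p \<in> Fix_on D (S m)" and weak: "weakly_converges u p"
    using asymptotically_regular_iterates_weakly_converge[where X = u, OF closed convex _ S_nonexpansive u _ nonempty]
      S_closed[of m] by blast
  have "weakly_converges (\<lambda>k. S i (u k)) (S i p)" if i: "i \<le> m" for i
    unfolding weakly_converges_def
  proof
    fix v
    have "(\<lambda>k. u k \<bullet> v + (S i (u k) - u k) \<bullet> v) \<longlonglongrightarrow> p \<bullet> v + (S i p - p) \<bullet> v"
      using weak[unfolded weakly_converges_def] orbit_displacements_converge[where u = u, OF p uD u(2) i]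
      by (intro tendsto_add) (auto intro: tendsto_inner)
    then show "(\<lambda>k. S i (u k) \<bullet> v) \<longlonglongrightarrow> S i p \<bullet> v"
      by (simp add: inner_diff_left)
  qed
  with p show ?thesis by (rule that)
qed

text \<open>Moving \<open>S i v\<close> back to \<open>v\<close> before the next operator acts costs nothing by nonexpansiveness, so all
  displacements on the right are taken at \<open>v\<close> itself.\<close>

lemma S_displacement_le:
  assumes "i \<le> m" "v \<in> D"
  shows "norm (S i v - v) \<le> \<epsilon> * (\<Sum>j<m. norm (T (Suc j) v - v))"
proof -
  have "norm (S i v - v) \<le> \<epsilon> * (\<Sum>j<i. norm (T (Suc j) v - v))"
    using assms(1)
  proof (induction i)
    case (Suc i)
    let ?\<rho> = "relaxation \<epsilon> (T (Suc i))"
    have "norm (?\<rho> (S i v) - ?\<rho> v) \<le> norm (S i v - v)"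
      using Suc.prems S_closed assms(2) T_nonexpansive relaxed
      by (intro relaxation_nonexpansive) auto
    moreover have "norm (?\<rho> v - v) = \<epsilon> * norm (T (Suc i) v - v)"
      using relaxed by (simp add: relaxation_def)
    ultimately show ?case
      using Suc norm_triangle_ineq[of "?\<rho> (S i v) - ?\<rho> v" "?\<rho> v - v"]
      by (simp add: cyclic_comp_Suc distrib_left)
  qed simp
  also have "\<dots> \<le> \<epsilon> * (\<Sum>j<m. norm (T (Suc j) v - v))"
    using assms(1) relaxed by (intro mult_left_mono sum_mono2) auto
  finally show ?thesis .
qed

text \<open>The displacements \<open>T (Suc j) (S j p) - S j p\<close> sum to zero because the cycle closes up, while
  \<open>m\<close> times the residual is the corresponding sum with \<open>S j p\<close> replaced by \<open>p\<close>. Each replacement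
  costs at most twice the distance from \<open>S j p\<close> to \<open>p\<close>.\<close>

lemma fixed_point_residual_le:
  assumes p: "p \<in> Fix_on D (S m)"
  shows "norm (p - average_op m T p) \<le> 2 * \<epsilon> * (\<Sum>j<m. norm (T (Suc j) p - p))"
    (is "_ \<le> 2 * \<epsilon> * ?M")
proof -
  have pD: "p \<in> D" and Sp: "S m p = p" using p by (auto simp: Fix_on_def)
  have zero: "(\<Sum>j<m. T (Suc j) (S j p) - S j p) = 0"
    using cyclic_comp_displacement[of m T \<epsilon> p] Sp relaxed by simp
  have "real m *\<^sub>R (p - average_op m T p) = (\<Sum>j<m. p - T (Suc j) p)"
    using m_pos by (simp add: average_op_def scaleR_diff_right sum_subtractf sum.atLeast1_atMost_eq
        sum_constant_scaleR)
  also have "\<dots> = (\<Sum>j<m. (p - S j p) + (T (Suc j) (S j p) - T (Suc j) p))"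
    using zero by (simp add: sum_subtractf sum.distrib)
  also have "norm \<dots> \<le> (\<Sum>j<m. 2 * (\<epsilon> * ?M))"
  proof (rule sum_norm_le)
    fix j assume "j \<in> {..<m}"
    then show "norm ((p - S j p) + (T (Suc j) (S j p) - T (Suc j) p)) \<le> 2 * (\<epsilon> * ?M)"
      using S_displacement_le[of j p] T_nonexpansive[of j "S j p" p] S_closed[of j p] pD
      by (intro order_trans[OF norm_triangle_ineq]) (simp add: norm_minus_commute)
  qed
  finally have "real m * norm (p - average_op m T p) \<le> real m * (2 * (\<epsilon> * ?M))"
    by simp
  then show ?thesis using m_pos by simp
qed

end

section \<open>Conditioning of the averaged operator\<close>

lemma average_op_nonexpansive:
  fixes T :: "nat \<Rightarrow> 'a::real_inner \<Rightarrow> 'a"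
  assumes "0 < m" "\<And>i. i \<in> {1..m} \<Longrightarrow> 1-lipschitz_on D (T i)" "v \<in> D" "w \<in> D"
  shows "norm (average_op m T v - average_op m T w) \<le> norm (v - w)"
proof -
  have "norm (\<Sum>i=1..m. T i v - T i w) \<le> (\<Sum>i=1..m. norm (v - w))"
    using lipschitz_on_normD[OF assms(2,3,4)] by (intro sum_norm_le) auto
  then have "norm (\<Sum>i=1..m. T i v - T i w) \<le> real m * norm (v - w)" by simp
  then show ?thesis
    using assms(1) by (simp add: average_op_def sum_subtractf[symmetric] scaleR_diff_right[symmetric]
        pos_divide_le_eq mult.commute)
qed

text \<open>Let \<open>w\<close> be the point of the segment from \<open>a\<close> to \<open>v\<close> at distance \<open>min \<delta> (norm (v - a))\<close> from
  \<open>a\<close>, where the local hypothesis applies. Monotonicity of \<open>Id - f\<close> says that the residual at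
  \<open>v\<close> has at least as large a component along the segment as the residual at \<open>w\<close>.\<close>

lemma residual_lower_bound:
  fixes f :: "'a::real_inner \<Rightarrow> 'a"
  assumes D: "convex D" "a \<in> D" "v \<in> D"
    and f: "\<And>v w. v \<in> D \<Longrightarrow> w \<in> D \<Longrightarrow> norm (f v - f w) \<le> norm (v - w)"
    and "0 < \<delta>"
    and coercive: "\<And>v. v \<in> D \<inter> cball a \<delta> \<Longrightarrow> \<alpha> * (norm (v - a))\<^sup>2 \<le> (v - a) \<bullet> (v - f v)"
  shows "\<alpha> * min \<delta> (norm (v - a)) \<le> norm (v - f v)"
proof (cases "v = a")
  case False
  define r where "r = norm (v - a)"
  define t where "t = min 1 (\<delta> / r)"
  define w where "w = a + t *\<^sub>R (v - a)"
  have r: "0 < r" using False unfolding r_def by simp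
  have t: "0 < t" "t \<le> 1" "t * r = min \<delta> r"
    unfolding t_def using r \<open>0 < \<delta>\<close> by (auto simp: min_def field_simps)
  have wa: "norm (w - a) = t * r"
    unfolding w_def r_def using t by simp
  have "w = (1 - t) *\<^sub>R a + t *\<^sub>R v" unfolding w_def by (simp add: algebra_simps)
  then have w: "w \<in> D" using convexD[OF D, of "1 - t" t] t by simp
  have mono: "0 \<le> (v - w) \<bullet> ((v - f v) - (w - f w))"
  proof -
    have "(v - w) \<bullet> (f v - f w) \<le> norm (v - w) * norm (f v - f w)"
      by (rule norm_cauchy_schwarz)
    also have "\<dots> \<le> norm (v - w) * norm (v - w)"
      using f[OF D(3) w] by (intro mult_left_mono) auto
    also have "\<dots> = (v - w) \<bullet> (v - w)"
      by (simp add: power2_norm_eq_inner[symmetric] power2_eq_square)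
    finally show ?thesis by (simp add: inner_simps)
  qed
  have vw: "v - w = (1 - t) *\<^sub>R (v - a)" "w - a = t *\<^sub>R (v - a)"
    unfolding w_def by (simp_all add: algebra_simps)
  have ray: "(w - a) \<bullet> (w - f w) \<le> (w - a) \<bullet> (v - f v)"
  proof (cases "t = 1")
    case True
    then show ?thesis unfolding w_def by simp
  next
    case False
    then have "0 \<le> (v - a) \<bullet> ((v - f v) - (w - f w))"
      using mono t unfolding vw by (simp add: zero_le_mult_iff)
    then have "0 \<le> t * ((v - a) \<bullet> ((v - f v) - (w - f w)))"
      using t by simp
    then show ?thesis unfolding vw by (simp add: inner_diff_right right_diff_distrib)
  qed
  have "\<alpha> * (t * r)\<^sup>2 \<le> (w - a) \<bullet> (w - f w)"
    using coercive[of w] w wa t(3) by (simp add: dist_norm norm_minus_commute)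
  also note ray
  also have "(w - a) \<bullet> (v - f v) \<le> (t * r) * norm (v - f v)"
    using norm_cauchy_schwarz[of "w - a" "v - f v"] wa by simp
  finally have "(t * r) * (\<alpha> * (t * r)) \<le> (t * r) * norm (v - f v)"
    by (simp add: power2_eq_square mult_ac)
  then have "\<alpha> * (t * r) \<le> norm (v - f v)"
    using mult_pos_pos[OF t(1) r] by (simp only: mult_le_cancel_left_pos)
  then show ?thesis using t(3) unfolding r_def by simp
qed (use \<open>0 < \<delta>\<close> in simp)

section \<open>Convergence of the cycles\<close>

lemma norm_le_of_weakly_converges:
  assumes "weakly_converges X p" "\<And>n. norm (X n) \<le> B"
  shows "norm p \<le> B"
proof (cases "p = 0")
  case True
  then show ?thesis using order_trans[OF norm_ge_zero assms(2)] by simp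
next
  case False
  have "X n \<bullet> p \<le> B * norm p" for n
    using norm_cauchy_schwarz[of "X n" p] mult_right_mono[OF assms(2), of "norm p" n] by simp
  then have "p \<bullet> p \<le> B * norm p"
    using assms(1)[unfolded weakly_converges_def] LIMSEQ_le_const2 by blast
  then show ?thesis
    using False by (simp add: power2_norm_eq_inner[symmetric] power2_eq_square)
qed

theorem theorem3p7:
  fixes D :: "'a::{real_inner, complete_space} set"
    and m :: nat
    and T :: "nat \<Rightarrow> 'a \<Rightarrow> 'a"
    and \<eta> \<beta> \<alpha> \<delta> :: real
    and xbar y0 :: 'a
    and y :: "real \<Rightarrow> nat \<Rightarrow> 'a"
    and x :: "real \<Rightarrow> nat \<Rightarrow> 'a"
  assumes "D \<noteq> {}" and "closed D" and "convex D"
    and "m \<ge> 2"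
    and "\<And>i. i \<in> {1..m} \<Longrightarrow> T i ` D \<subseteq> D"
    and "\<And>i. i \<in> {1..m} \<Longrightarrow> 1-lipschitz_on D (T i)"
    and "0 < \<eta>" and "\<eta> \<le> 1" and "0 < \<beta>"
    and "\<And>\<epsilon>. \<epsilon> \<in> {0<..<\<eta>} \<Longrightarrow> \<exists>z \<in> Fix_on D (cyclic_comp m T \<epsilon>). norm z \<le> \<beta>"
    and "Fix_on D (average_op m T) = {xbar}"
    and "0 < \<alpha>" and "0 < \<delta>"
    and "\<And>v. v \<in> D \<inter> cball xbar \<delta> \<Longrightarrow>
           (v - xbar) \<bullet> (v - average_op m T v) \<ge> \<alpha> * (norm (v - xbar))\<^sup>2"
    and "y0 \<in> D"
    and "\<And>\<epsilon>. \<epsilon> \<in> {0<..<\<eta>} \<Longrightarrow> y \<epsilon> 0 = y0"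
    and "\<And>\<epsilon> k i. \<epsilon> \<in> {0<..<\<eta>} \<Longrightarrow> i \<in> {1..m} \<Longrightarrow>
           y \<epsilon> (k * m + i) = relaxation \<epsilon> (T i) (y \<epsilon> (k * m + i - 1))"
    and "\<And>\<epsilon> i. \<epsilon> \<in> {0<..<\<eta>} \<Longrightarrow> i \<in> {1..m} \<Longrightarrow>
           x \<epsilon> i = weak_lim (\<lambda>k. y \<epsilon> (k * m + i))"
  shows "\<forall>i \<in> {1..m}. ((\<lambda>\<epsilon>. x \<epsilon> i) \<longlongrightarrow> xbar) (at_right 0)"
proof
  fix i assume i: "i \<in> {1..m}"
  have a: "xbar \<in> D" using assms(11) unfolding Fix_on_def by blast
  have m: "0 < m" using assms(4) by simp
  \<comment> \<open>\<open>B\<close> bounds the distance from \<open>p\<close> to \<open>xbar\<close>, because \<open>p\<close> lies within \<open>norm y0 + \<beta>\<close> of a fixed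
    point of norm at most \<open>\<beta>\<close>; \<open>M\<close> then bounds the sum of the displacements of \<open>p\<close>.\<close>
  define B where "B = norm y0 + 2 * \<beta> + norm xbar"
  define M where "M = (\<Sum>j<m. norm (T (Suc j) xbar - xbar) + 2 * B)"
  have B: "0 < B" unfolding B_def using assms(9) by (simp add: add_nonneg_pos add_pos_nonneg)
  have M: "0 < M" unfolding M_def using m B by (intro sum_pos) (auto intro: add_nonneg_pos)
  have bound: "norm (x \<epsilon> i - xbar) \<le> (2 / \<alpha> + 1) * M * \<epsilon>"
    if \<epsilon>: "\<epsilon> \<in> {0<..<\<eta>}" and small: "2 * \<epsilon> * M < \<alpha> * \<delta>" for \<epsilon>
  proof -
    interpret relaxed_cycle D m T \<epsilon>
      using assms(2-6,8) \<epsilon> by unfold_locales auto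
    obtain z where z: "z \<in> Fix_on D (S m)" "norm z \<le> \<beta>" using assms(10)[OF \<epsilon>] by blast
    define u where "u k = y \<epsilon> (k * m)" for k
    have stages: "y \<epsilon> (k * m + j) = S j (u k)" if "j \<le> m" for j k
      using that
    proof (induction j)
      case (Suc j)
      then show ?case using assms(17)[OF \<epsilon>, of "Suc j" k] by (simp add: cyclic_comp_Suc)
    qed (simp add: u_def)
    have u: "u 0 \<in> D" "u (Suc k) = S m (u k)" for k
      using assms(15,16) \<epsilon> stages[of m k] by (simp_all add: u_def add.commute)
    have uD: "u k \<in> D" for k
      using u S_closed[of m] by (induction k) auto
    obtain p where p: "p \<in> Fix_on D (S m)"
      and weak: "\<And>i. i \<le> m \<Longrightarrow> weakly_converges (\<lambda>k. S i (u k)) (S i p)"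
      using orbit_weakly_converges[where u = u, OF _ u] z by blast
    have pD: "p \<in> D" using p by (simp add: Fix_on_def)
    have xi: "x \<epsilon> i = S i p"
      using assms(18)[OF \<epsilon> i] weak[of i] i by (simp add: stages weak_lim_eq)
    have "norm (u k) \<le> norm y0 + 2 * \<beta>" for k
    proof -
      have "norm (u k - z) \<le> norm (u 0 - z)"
        using decseqD[OF orbit_distance_decreasing[where u = u, OF z(1) uD u(2)], of 0 k] by simp
      moreover have "u 0 = y0" using assms(16)[OF \<epsilon>] by (simp add: u_def)
      ultimately show ?thesis
        using z(2) norm_triangle_ineq4[of y0 z] norm_triangle_sub[of "u k" z] by simp
    qed
    then have "norm p \<le> norm y0 + 2 * \<beta>"
      using norm_le_of_weakly_converges[of u p] weak[of 0] by simp
    then have pB: "norm (p - xbar) \<le> B"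
      unfolding B_def using norm_triangle_ineq4[of p xbar] by simp
    have MM: "(\<Sum>j<m. norm (T (Suc j) p - p)) \<le> M"
      unfolding M_def
    proof (rule sum_mono)
      fix j assume "j \<in> {..<m}"
      then have "norm (T (Suc j) p - T (Suc j) xbar) \<le> norm (p - xbar)"
        using T_nonexpansive pD a by simp
      then show "norm (T (Suc j) p - p) \<le> norm (T (Suc j) xbar - xbar) + 2 * B"
        using pB norm_triangle_ineq4[of "T (Suc j) p - T (Suc j) xbar" "p - xbar"]
          norm_triangle_ineq[of "(T (Suc j) p - T (Suc j) xbar) - (p - xbar)" "T (Suc j) xbar - xbar"]
        by (simp add: algebra_simps)
    qed
    have "norm (p - average_op m T p) \<le> 2 * \<epsilon> * M"
      using relaxed by (intro order_trans[OF fixed_point_residual_le[OF p]] mult_left_mono MM) simp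
    then have "\<alpha> * min \<delta> (norm (p - xbar)) \<le> 2 * \<epsilon> * M"
      using residual_lower_bound[OF convex a pD average_op_nonexpansive[OF m nonexpansive] assms(13,14)]
      by simp
    \<comment> \<open>For small \<open>\<epsilon>\<close> the minimum cannot be \<open>\<delta>\<close>.\<close>
    then have "\<alpha> * norm (p - xbar) \<le> 2 * \<epsilon> * M"
      using small by (simp add: min_def split: if_splits)
    then have "norm (p - xbar) \<le> 2 / \<alpha> * M * \<epsilon>"
      using assms(12) by (simp add: field_simps)
    moreover have "norm (S i p - p) \<le> M * \<epsilon>"
      using i relaxed order_trans[OF S_displacement_le[OF _ pD, of i] mult_left_mono[OF MM, of \<epsilon>]]
      by (simp add: mult.commute)
    ultimately show ?thesis
      unfolding xi using norm_triangle_ineq[of "S i p - p" "p - xbar"] by (simp add: algebra_simps)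
  qed
  have "\<forall>\<^sub>F \<epsilon> in at_right 0. \<epsilon> \<in> {0<..<min \<eta> (\<alpha> * \<delta> / (2 * M))}"
    using assms(7,12,13) M by (intro eventually_at_right_real) simp
  then have "\<forall>\<^sub>F \<epsilon> in at_right 0. norm (x \<epsilon> i - xbar) \<le> (2 / \<alpha> + 1) * M * \<epsilon>"
    by (rule eventually_mono) (rule bound, use M in \<open>auto simp: field_simps\<close>)
  moreover have "((\<lambda>\<epsilon>. (2 / \<alpha> + 1) * M * \<epsilon>) \<longlongrightarrow> (2 / \<alpha> + 1) * M * 0) (at_right 0)"
    by (intro tendsto_intros)
  ultimately have "((\<lambda>\<epsilon>. x \<epsilon> i - xbar) \<longlongrightarrow> 0) (at_right 0)"
    using Lim_null_comparison[of "\<lambda>\<epsilon>. x \<epsilon> i - xbar"] by simp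
  then show "((\<lambda>\<epsilon>. x \<epsilon> i) \<longlongrightarrow> xbar) (at_right 0)"
    by (rule LIM_zero_cancel)
qed

end
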